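(* Let $D=\{0,1\}$, $k\ge1$, and let $\mathcal{F}=\langle f_1,\dots,f_k\rangle:D^k\to D^k$ with each $f_i:D^k\to D$. The following are equivalent: (1) $\mathcal{F}$ is a multimorphism of every function in $\Gamma_{\mathsf{sub},2}$; (2) $\mathcal{F}$ is a multimorphism of every function in $\Gamma^{\infty}_{\mathsf{sub},2}$; (3) $\mathcal{F}$ is conservative and Hamming distance non-increasing.
   Context: A cost function of arity $n$ on $D$ is a map $D^n\to\mathbb{R}\cup\{\infty\}$. On $D=\{0,1\}$ with $0<1$, a cost function $\phi$ is submodular if $\phi(\min(u,v))+\phi(\max(u,v))\le\phi(u)+\phi(v)$ for all $u,v\in D^n$ (min, max coordinatewise; arithmetic in $\mathbb{R}\cup\{\infty\}$). $\Gamma_{\mathsf{sub},2}$ is the set of finite-valued (real-valued) submodular cost functions on $D$ of arity at most $2$, and $\Gamma^{\infty}_{\mathsf{sub},2}$ is the set of submodular cost functions on $D$ of arity at most $2$ taking values in $\mathbb{R}\cup\{\infty\}$. Operations $f:D^k\to D$ are extended to tuples coordinatewise: for $t_1,\dots,t_k\in D^n$, $f(t_1,\dots,t_k)=\langle f(t_1[1],\dots,t_k[1]),\dots,f(t_1[n],\dots,t_k[n])\rangle$. $\mathcal{F}=\langle f_1,\dots,f_k\rangle$ is a multimorphism of an $n$-ary cost function $\phi$ if for all $t_1,\dots,t_k\in D^n$, $\sum_{i=1}^k\phi(t_i)\ge\sum_{i=1}^k\phi(f_i(t_1,\dots,t_k))$. $\mathcal{F}$ is conservative if for every $(x_1,\dots,x_k)\in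 D^k$ the tuple $\mathcal{F}(x_1,\dots,x_k)$ contains the same multiset of values as $(x_1,\dots,x_k)$. $\mathcal{F}$ is Hamming distance non-increasing if $H(\mathcal{F}(\mathbf{u}),\mathcal{F}(\mathbf{v}))\le H(\mathbf{u},\mathbf{v})$ for all $\mathbf{u},\mathbf{v}\in D^k$, where $H$ is the number of positions in which two tuples differ. *)

theory Defs
  imports "HOL-Library.Extended_Real" "HOL-Library.Multiset" "HOL-Library.FuncSet"
begin

text \<open>
  The domain \<open>D\<close> is a type; \<open>{0,1}\<close> with \<open>0 < 1\<close> is the type \<^typ>\<open>bool\<close> with its order
  \<^prop>\<open>False < True\<close>. Elements of \<open>D\<^sup>n\<close> are lists of length \<open>n\<close>, positions counted from \<open>0\<close>.
  Functions on \<open>D\<^sup>n\<close> are total functions on lists, of which only the values on lists of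
  length \<open>n\<close> are ever used.
\<close>

definition tuples :: "nat \<Rightarrow> 'd list set" where
  "tuples n = {t. length t = n}"

text \<open>\<open>{-\<infinity><..}\<close> is \<open>\<real> \<union> {\<infinity>}\<close> inside the extended reals.\<close>

definition cost_function :: "nat \<Rightarrow> ('d list \<Rightarrow> ereal) \<Rightarrow> bool" where
  "cost_function n \<phi> \<longleftrightarrow> \<phi> \<in> tuples n \<rightarrow> {-\<infinity><..}"

definition finite_valued :: "nat \<Rightarrow> ('d list \<Rightarrow> ereal) \<Rightarrow> bool" where
  "finite_valued n \<phi> \<longleftrightarrow> \<phi> \<in> tuples n \<rightarrow> range ereal"

definition submodular :: "nat \<Rightarrow> ('d::linorder list \<Rightarrow> ereal) \<Rightarrow> bool" where
  "submodular n \<phi> \<longleftrightarrow>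
     (\<forall>u \<in> tuples n. \<forall>v \<in> tuples n. \<phi> (map2 min u v) + \<phi> (map2 max u v) \<le> \<phi> u + \<phi> v)"

text \<open>A cost function is paired with its arity.\<close>

definition Gamma_sub2_inf :: "(nat \<times> (bool list \<Rightarrow> ereal)) set" where
  "Gamma_sub2_inf = {(n, \<phi>). n \<le> 2 \<and> cost_function n \<phi> \<and> submodular n \<phi>}"

definition Gamma_sub2 :: "(nat \<times> (bool list \<Rightarrow> ereal)) set" where
  "Gamma_sub2 = {(n, \<phi>). n \<le> 2 \<and> finite_valued n \<phi> \<and> submodular n \<phi>}"

definition extend_op :: "nat \<Rightarrow> ('d list \<Rightarrow> 'd) \<Rightarrow> 'd list list \<Rightarrow> 'd list" where
  "extend_op n f ts = map (\<lambda>j. f (map (\<lambda>t. t ! j) ts)) [0..<n]"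

text \<open>The tuple \<open>\<langle>f\<^sub>1, \<dots>, f\<^sub>k\<rangle>\<close> is the list of its components, so that \<open>k\<close> is its length.\<close>

definition apply_ops :: "('d list \<Rightarrow> 'd) list \<Rightarrow> 'd list \<Rightarrow> 'd list" where
  "apply_ops F x = map (\<lambda>f. f x) F"

definition multimorphism :: "('d list \<Rightarrow> 'd) list \<Rightarrow> nat \<Rightarrow> ('d list \<Rightarrow> ereal) \<Rightarrow> bool" where
  "multimorphism F n \<phi> \<longleftrightarrow>
     (\<forall>ts. length ts = length F \<longrightarrow> set ts \<subseteq> tuples n \<longrightarrow>
        (\<Sum>t\<leftarrow>ts. \<phi> t) \<ge> (\<Sum>f\<leftarrow>F. \<phi> (extend_op n f ts)))"

definition conservative :: "('d list \<Rightarrow> 'd) list \<Rightarrow> bool" where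
  "conservative F \<longleftrightarrow> (\<forall>x \<in> tuples (length F). mset (apply_ops F x) = mset x)"

definition hamming :: "'d list \<Rightarrow> 'd list \<Rightarrow> nat" where
  "hamming u v = card {i. i < length u \<and> u ! i \<noteq> v ! i}"

definition hamming_nonincreasing :: "('d list \<Rightarrow> 'd) list \<Rightarrow> bool" where
  "hamming_nonincreasing F \<longleftrightarrow>
     (\<forall>u \<in> tuples (length F). \<forall>v \<in> tuples (length F).
        hamming (apply_ops F u) (apply_ops F v) \<le> hamming u v)"

end

theory Submission
  imports Defs
begin

text \<open>
  For two columns \<open>u, v\<close> of a \<open>k \<times> 2\<close> matrix, conservativity fixes the number of ones in each
  column of the image matrix. So the image rows arise from the given rows by replacing, for some
  integer \<open>d\<close>, \<open>d\<close> pairs of rows \<open>01, 10\<close> by pairs \<open>00, 11\<close>, and the Hamming condition says exactly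
  \<open>d \<ge> 0\<close>. Each replacement does not increase the cost of a submodular function. Conversely, the
  unary functions \<open>x\<close> and \<open>-x\<close> force conservativity, and the submodular function
  \<open>[x \<noteq> y]\<close> sums to the Hamming distance.
\<close>

lemma hamming_Nil [simp]: "hamming [] v = 0"
  by (simp add: hamming_def)

lemma hamming_Cons [simp]:
  "hamming (x # u) (y # v) = of_bool (x \<noteq> y) + hamming u v"
proof -
  let ?A = "{i. i < length u \<and> u ! i \<noteq> v ! i}"
  have "{i. i < length (x # u) \<and> (x # u) ! i \<noteq> (y # v) ! i} =
          (if x \<noteq> y then {0} else {}) \<union> Suc ` ?A" (is "?L = ?R")
  proof (rule set_eqI)
    fix i show "i \<in> ?L \<longleftrightarrow> i \<in> ?R" by (cases i) auto
  qed
  moreover have "card ((if x \<noteq> y then {0} else {}) \<union> Suc ` ?A) = of_bool (x \<noteq> y) + card ?A"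
    by (subst card_Un_disjoint) (auto simp: card_image)
  ultimately show ?thesis
    by (simp add: hamming_def)
qed

lemma hamming_map:
  "hamming (map f xs) (map g xs) = (\<Sum>x\<leftarrow>xs. of_bool (f x \<noteq> g x))"
  by (induction xs) auto

lemma sum_list_map_ereal: "(\<Sum>x\<leftarrow>xs. ereal (g x)) = ereal (\<Sum>x\<leftarrow>xs. g x)"
  by (induction xs) auto

lemma real_sum_list: "real (\<Sum>x\<leftarrow>xs. g x) = (\<Sum>x\<leftarrow>xs. real (g x))"
  by (induction xs) auto

lemma length_eq_2_iff: "length t = 2 \<longleftrightarrow> (\<exists>a b. t = [a, b])"
  by (auto simp: numeral_2_eq_2 length_Suc_conv)

lemma tuples_1: "t \<in> tuples 1 \<longleftrightarrow> (\<exists>a. t = [a])"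
  by (auto simp: tuples_def length_Suc_conv)

lemma tuples_2: "t \<in> tuples 2 \<longleftrightarrow> (\<exists>a b. t = [a, b])"
  by (auto simp: tuples_def length_eq_2_iff)

lemma count_True_add_count_False:
  "count (mset (xs :: bool list)) True + count (mset xs) False = length xs"
  by (induction xs) auto

lemma mset_bool_eq_iff:
  assumes "length xs = length (ys :: bool list)"
  shows "mset xs = mset ys \<longleftrightarrow> count (mset xs) True = count (mset ys) True"
proof
  assume *: "count (mset xs) True = count (mset ys) True"
  show "mset xs = mset ys"
  proof (rule multiset_eqI)
    fix b show "count (mset xs) b = count (mset ys) b"
      using * assms count_True_add_count_False[of xs] count_True_add_count_False[of ys]
      by (cases b) auto
  qed
qed simp

text \<open>The factor \<open>c\<close> lets one identity serve for unary costs of both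
  signs.\<close>

lemma sum_list_count_True:
  "(\<Sum>x\<leftarrow>xs. c * of_bool (p x)) = (c::real) * real (count (mset (map p xs)) True)"
  by (induction xs) (auto simp: algebra_simps)

lemma Gamma_sub2_subset: "Gamma_sub2 \<subseteq> Gamma_sub2_inf"
  by (auto simp: Gamma_sub2_def Gamma_sub2_inf_def finite_valued_def cost_function_def)

text \<open>In a chain, \<open>min a b\<close> and \<open>max a b\<close> are \<open>a\<close> and
  \<open>b\<close> in some order, so every unary function satisfies the inequality with
  equality.\<close>

lemma unary_mem_Gamma_sub2: "(1, \<lambda>t. ereal (g (t ! 0))) \<in> Gamma_sub2"
proof -
  have "g (min a b) + g (max a b) \<le> g a + g b" for a b
    by (cases a; cases b) auto
  then show ?thesis
    by (auto simp: Gamma_sub2_def finite_valued_def submodular_def tuples_1[simplified])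
qed

text \<open>This is the cut function of a single edge. Comparable tuples give equality; the
  incomparable pair \<open>[False, True]\<close>, \<open>[True, False]\<close> gives 0 against
  2.\<close>

lemma disequality_mem_Gamma_sub2: "(2, \<lambda>t. ereal (of_bool (t ! 0 \<noteq> t ! 1))) \<in> Gamma_sub2"
  by (auto simp: Gamma_sub2_def finite_valued_def submodular_def tuples_2 min_def max_def)

lemma conservative_if_multimorphism_unary:
  assumes "\<And>n \<phi>. (n, \<phi>) \<in> Gamma_sub2 \<Longrightarrow> multimorphism F n \<phi>"
  shows "conservative F"
  unfolding conservative_def
proof
  fix x :: "bool list" assume x: "x \<in> tuples (length F)"
  \<comment> \<open>The sign of \<open>c\<close> is free: 1 and -1 yield opposite inequalities
    between the two numbers of ones. The matrix used below has the single column
    \<open>x\<close>.\<close>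
  have ineq: "c * real (count (mset (apply_ops F x)) True) \<le> c * real (count (mset x) True)"
    for c
  proof -
    let ?\<phi> = "\<lambda>t. ereal (c * of_bool (t ! 0))"
    have "multimorphism F 1 ?\<phi>"
      by (rule assms[OF unary_mem_Gamma_sub2])
    then have "(\<Sum>f\<leftarrow>F. ?\<phi> (extend_op 1 f (map (\<lambda>b. [b]) x))) \<le> (\<Sum>t\<leftarrow>map (\<lambda>b. [b]) x. ?\<phi> t)"
      unfolding multimorphism_def
      by (elim allE[of _ "map (\<lambda>b. [b]) x"]) (use x in \<open>auto simp: tuples_def\<close>)
    then show ?thesis
      by (simp add: sum_list_map_ereal extend_op_def comp_def sum_list_count_True apply_ops_def)
  qed
  have "length (apply_ops F x) = length x"
    using x by (simp add: apply_ops_def tuples_def)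
  then show "mset (apply_ops F x) = mset x"
    using ineq[of 1] ineq[of "-1"] by (simp add: mset_bool_eq_iff)
qed

lemma hamming_nonincreasing_if_multimorphism_disequality:
  fixes F :: "('d list \<Rightarrow> 'd) list"
  assumes "multimorphism F 2 (\<lambda>t. ereal (of_bool (t ! 0 \<noteq> t ! 1)))"
  shows "hamming_nonincreasing F"
  unfolding hamming_nonincreasing_def
proof (intro ballI)
  fix u v :: "'d list" assume "u \<in> tuples (length F)" "v \<in> tuples (length F)"
  then have len: "length u = length F" "length v = length F"
    by (auto simp: tuples_def)
  \<comment> \<open>The rows of the matrix with columns \<open>u\<close> and \<open>v\<close>;
    summed over them, the cost counts the positions where the columns differ.\<close>
  define ts where "ts = map2 (\<lambda>a b. [a, b]) u v"
  have u: "map (\<lambda>t. t ! 0) ts = u" and v: "map (\<lambda>t. t ! Suc 0) ts = v"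
    using len by (auto simp: ts_def intro!: nth_equalityI)
  have "set ts \<subseteq> tuples 2" "length ts = length F"
    using len by (auto simp: ts_def tuples_def)
  then have "(\<Sum>f\<leftarrow>F. of_bool (f u \<noteq> f v)) \<le> (\<Sum>t\<leftarrow>ts. of_bool (t ! 0 \<noteq> t ! 1) :: real)"
    using assms unfolding multimorphism_def
    by (auto simp: sum_list_map_ereal extend_op_def u v numeral_2_eq_2)
  moreover have "real (hamming (apply_ops F u) (apply_ops F v)) = (\<Sum>f\<leftarrow>F. of_bool (f u \<noteq> f v))"
    by (simp add: apply_ops_def hamming_map real_sum_list)
  moreover have "real (hamming u v) = (\<Sum>t\<leftarrow>ts. of_bool (t ! 0 \<noteq> t ! 1))"
    by (subst u[symmetric], subst v[symmetric]) (simp add: hamming_map real_sum_list)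
  ultimately show "hamming (apply_ops F u) (apply_ops F v) \<le> hamming u v"
    by linarith
qed

text \<open>Four independent linear equations for the numbers of rows of the four types, later
  compared between \<open>ts\<close> and \<open>ss\<close>.\<close>

lemma row_counts:
  assumes "set ts \<subseteq> tuples 2"
  shows "count (mset (map (\<lambda>t. t ! 0) ts)) True
           = count (mset ts) [True, False] + count (mset ts) [True, True]"
    and "count (mset (map (\<lambda>t. t ! 1) ts)) True
           = count (mset ts) [False, True] + count (mset ts) [True, True]"
    and "hamming (map (\<lambda>t. t ! 0) ts) (map (\<lambda>t. t ! 1) ts)
           = count (mset ts) [True, False] + count (mset ts) [False, True]"
    and "length ts = count (mset ts) [False, False] + count (mset ts) [False, True]
           + count (mset ts) [True, False] + count (mset ts) [True, True]"
  using assms by (induction ts) (auto simp: tuples_2)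

text \<open>Equal lengths and equal column counts leave one degree of freedom: the counts of 01 and
  10 drop by some integer \<open>d\<close> while those of 00 and 11 grow by \<open>d\<close>. The
  Hamming distance then drops by \<open>2 * d\<close>, so \<open>ham\<close> gives \<open>d\<close>
  \<ge> 0.\<close>

lemma uncrossing_decomposition:
  assumes ts: "set ts \<subseteq> tuples 2" and ss: "set ss \<subseteq> tuples 2"
    and len: "length ss = length ts"
    and col0: "mset (map (\<lambda>t. t ! 0) ss) = mset (map (\<lambda>t. t ! 0) ts)"
    and col1: "mset (map (\<lambda>t. t ! 1) ss) = mset (map (\<lambda>t. t ! 1) ts)"
    and ham: "hamming (map (\<lambda>t. t ! 0) ss) (map (\<lambda>t. t ! 1) ss)
                \<le> hamming (map (\<lambda>t. t ! 0) ts) (map (\<lambda>t. t ! 1) ts)"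
  obtains C d where
    "mset ts = C + repeat_mset d {#[False, True], [True, False]#}"
    "mset ss = C + repeat_mset d {#[False, False], [True, True]#}"
proof
  \<comment> \<open>Truncated subtraction is harmless because \<open>ham\<close> makes the true
    difference nonnegative. For the same reason \<open>ts\<close> contains all the pairs removed in
    \<open>?C\<close>.\<close>
  let ?d = "count (mset ts) [True, False] - count (mset ss) [True, False]"
  let ?C = "mset ts - repeat_mset ?d {#[False, True], [True, False]#}"
  note rc = row_counts[OF ts] row_counts[OF ss]
  \<comment> \<open>The multiset equations range over all lists, so lengths other than 2 must be
    covered too.\<close>
  have outside: "count (mset ts) t = 0" "count (mset ss) t = 0" if "t \<notin> tuples 2" for t
    using that ts ss by (auto simp: count_eq_zero_iff)
  have eqs: "count (mset ts) [True, False] = count (mset ss) [True, False] + ?d"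
    "count (mset ts) [False, True] = count (mset ss) [False, True] + ?d"
    "count (mset ss) [True, True] = count (mset ts) [True, True] + ?d"
    "count (mset ss) [False, False] = count (mset ts) [False, False] + ?d"
    using rc len ham col0 col1 by simp_all
  show "mset ts = ?C + repeat_mset ?d {#[False, True], [True, False]#}"
  proof (rule multiset_eqI)
    fix t :: "bool list"
    show "count (mset ts) t = count (?C + repeat_mset ?d {#[False, True], [True, False]#}) t"
      using eqs(1,2) by auto
  qed
  show "mset ss = ?C + repeat_mset ?d {#[False, False], [True, True]#}"
  proof (rule multiset_eqI)
    fix t :: "bool list"
    show "count (mset ss) t = count (?C + repeat_mset ?d {#[False, False], [True, True]#}) t"
    proof (cases "t \<in> tuples 2")
      case True
      then obtain a b where "t = [a, b]" by (auto simp: tuples_2)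
      then show ?thesis using eqs by (cases a; cases b) auto
    next
      case False
      then have "t \<noteq> [False, False]" "t \<noteq> [True, True]" by (auto simp: tuples_2)
      then show ?thesis by (simp add: outside[OF False])
    qed
  qed
qed

text \<open>Each uncrossing is submodularity at 01 and 10, whose minimum is 00 and maximum 11.
  Inequalities are only added, never cancelled, so infinite costs do no harm.\<close>

lemma sum_mset_uncross_le:
  assumes "submodular 2 \<phi>"
  shows "(\<Sum>t\<in>#C + repeat_mset d {#[False, False], [True, True]#}. \<phi> t)
           \<le> (\<Sum>t\<in>#C + repeat_mset d {#[False, True], [True, False]#}. \<phi> t)"
proof (induction d)
  case (Suc d)
  have "[False, True] \<in> tuples 2" "[True, False] \<in> tuples 2"
    by (auto simp: tuples_def)
  with assms have "\<phi> [False, False] + \<phi> [True, True] \<le> \<phi> [False, True] + \<phi> [True, False]"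
    unfolding submodular_def by fastforce
  from add_mono[OF this Suc.IH] show ?case
    by (simp add: ac_simps)
qed simp

lemma multimorphism_if_conservative_hamming_nonincreasing:
  assumes cons: "conservative F" and ham: "hamming_nonincreasing F"
    and mem: "(n, \<phi>) \<in> Gamma_sub2_inf"
  shows "multimorphism F n \<phi>"
  unfolding multimorphism_def
proof (intro allI impI)
  fix ts :: "bool list list"
  assume len: "length ts = length F" and ts: "set ts \<subseteq> tuples n"
  define ss where "ss = map (\<lambda>f. extend_op n f ts) F"
  define col where "col j = map (\<lambda>t. t ! j) ts" for j
  have col: "col j \<in> tuples (length F)" for j
    by (simp add: col_def tuples_def len)
  \<comment> \<open>Transposition: operations act on the matrix column by column, which is where
    both assumptions on \<open>F\<close> apply.\<close>
  have ss_col: "map (\<lambda>t. t ! j) ss = apply_ops F (col j)" if "j < n" for j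
    using that by (simp add: ss_def apply_ops_def extend_op_def col_def)
  have mset_col: "mset (map (\<lambda>t. t ! j) ss) = mset (map (\<lambda>t. t ! j) ts)" if "j < n" for j
    using cons col[of j] ss_col[OF that] by (simp add: conservative_def col_def)
  have ss: "set ss \<subseteq> tuples n" "length ss = length ts"
    by (auto simp: ss_def extend_op_def tuples_def len)
  have "n \<le> 2" and sub: "submodular n \<phi>"
    using mem by (auto simp: Gamma_sub2_inf_def)
  from \<open>n \<le> 2\<close> consider "n = 0" | "n = 1" | "n = 2" by linarith
  then have "(\<Sum>t\<in>#mset ss. \<phi> t) \<le> (\<Sum>t\<in>#mset ts. \<phi> t)"
  proof cases
    case 1
    \<comment> \<open>The empty tuple is the only possible row.\<close>
    have "ss = replicate (length ts) []" "ts = replicate (length ts) []"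
      using ts ss 1 by (auto simp: tuples_def intro!: replicate_eqI)
    then show ?thesis by simp
  next
    case 2
    \<comment> \<open>Rows of length 1 carry the same data as their only column, so conservativity
      already makes the two row multisets equal.\<close>
    have *: "mset rs = image_mset (\<lambda>b. [b]) (mset (map (\<lambda>t. t ! 0) rs))"
      if "set rs \<subseteq> tuples 1" for rs :: "bool list list"
      using that by (induction rs) (auto simp: tuples_1[simplified])
    have "mset ss = mset ts"
      using *[of ss] *[of ts] ss(1) ts mset_col[of 0] 2 by simp
    then show ?thesis by simp
  next
    case 3
    have "hamming (map (\<lambda>t. t ! 0) ss) (map (\<lambda>t. t ! 1) ss)
            \<le> hamming (map (\<lambda>t. t ! 0) ts) (map (\<lambda>t. t ! 1) ts)"
      using ham col[of 0] col[of 1] ss_col[of 0] ss_col[of 1] 3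
      by (simp add: hamming_nonincreasing_def col_def)
    then obtain C d where
      "mset ts = C + repeat_mset d {#[False, True], [True, False]#}"
      "mset ss = C + repeat_mset d {#[False, False], [True, True]#}"
      using uncrossing_decomposition[of ts ss] ts ss mset_col[of 0] mset_col[of 1] 3 by auto
    then show ?thesis
      using sum_mset_uncross_le sub 3 by simp
  qed
  then show "(\<Sum>f\<leftarrow>F. \<phi> (extend_op n f ts)) \<le> (\<Sum>t\<leftarrow>ts. \<phi> t)"
    by (simp add: ss_def multiset.map_comp comp_def flip: sum_mset_sum_list)
qed

theorem theorem2:
  fixes F :: "(bool list \<Rightarrow> bool) list" and k :: nat
  assumes "k \<ge> 1" and "length F = k"
  shows "((\<forall>(n, \<phi>) \<in> Gamma_sub2. multimorphism F n \<phi>) \<longleftrightarrow>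
          (\<forall>(n, \<phi>) \<in> Gamma_sub2_inf. multimorphism F n \<phi>)) \<and>
         ((\<forall>(n, \<phi>) \<in> Gamma_sub2_inf. multimorphism F n \<phi>) \<longleftrightarrow>
          conservative F \<and> hamming_nonincreasing F)"
proof -
  \<comment> \<open>The equivalences close as a cycle: finite-valued case, conditions on
    \<open>F\<close>, general case, and back by \<open>Gamma_sub2_subset\<close>.\<close>
  have "conservative F \<and> hamming_nonincreasing F"
    if "\<forall>(n, \<phi>) \<in> Gamma_sub2. multimorphism F n \<phi>"
    using that conservative_if_multimorphism_unary[of F] disequality_mem_Gamma_sub2
      hamming_nonincreasing_if_multimorphism_disequality[of F] by blast
  moreover have "\<forall>(n, \<phi>) \<in> Gamma_sub2_inf. multimorphism F n \<phi>"
    if "conservative F \<and> hamming_nonincreasing F"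
    using that multimorphism_if_conservative_hamming_nonincreasing by blast
  ultimately show ?thesis
    using Gamma_sub2_subset by blast
qed

end
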